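(* Let $\mathbf{RbC}$ be the logic obtained from $\mathbf{RmbC}$ by adding the axiom schema (cf): $\neg\neg\alpha\to\alpha$. Then $\mathbf{RbC}$ is an extension of the logic $\mathbf{bC}$ (that is, $\Gamma\vdash_{\mathbf{bC}}\varphi$ implies $\Gamma\vdash_{\mathbf{RbC}}\varphi$) which satisfies the replacement property and is paraconsistent (that is, $\varphi,\neg\varphi\nvdash_{\mathbf{RbC}}\psi$ for some formulas $\varphi,\psi$). Moreover, $\mathbf{RbC}$ is a Logic of Formal Inconsistency with respect to $\neg$ and $\circ$.
   Context: Let $\Sigma=\{\wedge,\vee,\to,\neg,\circ\}$ ($\neg,\circ$ unary, the others binary) and let $For(\Sigma)$ be the set of formulas over $\Sigma$ generated by a denumerable set $\mathcal V$ of propositional variables. $\alpha\leftrightarrow\beta$ abbreviates $(\alpha\to\beta)\wedge(\beta\to\alpha)$. The logic $\mathbf{mbC}$ is given by the Hilbert calculus with axiom schemas: (Ax1) $\alpha\to(\beta\to\alpha)$; (Ax2) $(\alpha\to(\beta\to\gamma))\to((\alpha\to\beta)\to(\alpha\to\gamma))$; (Ax3) $\alpha\to(\beta\to(\alpha\wedge\beta))$; (Ax4) $(\alpha\wedge\beta)\to\alpha$; (Ax5) $(\alpha\wedge\beta)\to\beta$; (Ax6) $\alpha\to(\alpha\vee\beta)$; (Ax7) $\beta\to(\alpha\vee\beta)$; (Ax8) $(\alpha\to\gamma)\to((\beta\to\gamma)\to((\alpha\vee\beta)\to\gamma))$; (Ax9) $(\alpha\to\beta)\vee\alpha$; (Ax10)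 $\alpha\vee\neg\alpha$; (bc1) $\circ\alpha\to(\alpha\to(\neg\alpha\to\beta))$; and the single rule modus ponens (MP): from $\alpha$ and $\alpha\to\beta$ infer $\beta$. The logic $\mathbf{bC}$ is $\mathbf{mbC}$ plus the axiom schema (cf); derivations from premises in $\mathbf{mbC}$ and $\mathbf{bC}$ are the usual Hilbert-style ones. The calculus $\mathbf{RmbC}$ is obtained from $\mathbf{mbC}$ by adding the rules $(\mathbf R_\neg)$: from $\alpha\leftrightarrow\beta$ infer $\neg\alpha\leftrightarrow\neg\beta$; and $(\mathbf R_\circ)$: from $\alpha\leftrightarrow\beta$ infer $\circ\alpha\leftrightarrow\circ\beta$. In $\mathbf{RmbC}$ and its axiomatic extensions, $\varphi$ is a theorem ($\vdash\varphi$) if there is a finite sequence of formulas ending in $\varphi$ each of which is an instance of an axiom schema or follows from earlier formulas of the sequence by a rule; and $\Gamma\vdash\varphi$ means that either $\vdash\varphi$ or there is a finite non-empty $\{\gamma_1,\dots,\gamma_n\}\subseteq\Gamma$ with $\vdash(\gamma_1\wedge(\gamma_2\wedge(\cdots\wedge(\gamma_{n-1}\wedge\gamma_n)\cdots)))\to\varphi$. Replacement property: if $\alpha\leftrightarrow\beta$ is a theorem, then $\gamma[p/\alpha]\leftrightarrow\gamma[p/\beta]$ is a theorem for every formula $\gamma$ and variable $p$, where $\gamma[p/\alpha]$ is the result of replacing every occurrence of $p$ in $\gamma$ by $\alpha$. A Tarskian (reflexive, monotone, transitive), finitary and structural (substitution-invariant) logic with consequence $\vdash$ is a Logic of Formal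 Inconsistency w.r.t. $\neg$ and $\circ$ if: (i) $\varphi,\neg\varphi\nvdash\psi$ for some $\varphi,\psi$; (ii) $\circ\varphi,\varphi,\neg\varphi\vdash\psi$ for all $\varphi,\psi$; (iii) there are formulas $\alpha,\beta$ such that $\circ\alpha,\alpha\nvdash\beta$ and $\circ\alpha,\neg\alpha\nvdash\beta$. *)

theory Defs
  imports Main
begin

datatype fm =
    Var nat
  | Conj fm fm (infixr \<open>\<^bold>\<and>\<close> 75)
  | Disj fm fm (infixr \<open>\<^bold>\<or>\<close> 70)
  | Imp fm fm (infixr \<open>\<^bold>\<rightarrow>\<close> 65)
  | Neg fm (\<open>\<^bold>\<not> _\<close> [80] 80)
  | Circ fm (\<open>\<^bold>\<circ> _\<close> [80] 80)

abbreviation Iff :: "fm \<Rightarrow> fm \<Rightarrow> fm" (infix \<open>\<^bold>\<leftrightarrow>\<close> 60) where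
  "\<alpha> \<^bold>\<leftrightarrow> \<beta> \<equiv> (\<alpha> \<^bold>\<rightarrow> \<beta>) \<^bold>\<and> (\<beta> \<^bold>\<rightarrow> \<alpha>)"

primrec subst :: "(nat \<Rightarrow> fm) \<Rightarrow> fm \<Rightarrow> fm" where
  "subst \<sigma> (Var p) = \<sigma> p"
| "subst \<sigma> (\<alpha> \<^bold>\<and> \<beta>) = subst \<sigma> \<alpha> \<^bold>\<and> subst \<sigma> \<beta>"
| "subst \<sigma> (\<alpha> \<^bold>\<or> \<beta>) = subst \<sigma> \<alpha> \<^bold>\<or> subst \<sigma> \<beta>"
| "subst \<sigma> (\<alpha> \<^bold>\<rightarrow> \<beta>) = (subst \<sigma> \<alpha> \<^bold>\<rightarrow> subst \<sigma> \<beta>)"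
| "subst \<sigma> (\<^bold>\<not> \<alpha>) = \<^bold>\<not> subst \<sigma> \<alpha>"
| "subst \<sigma> (\<^bold>\<circ> \<alpha>) = \<^bold>\<circ> subst \<sigma> \<alpha>"

definition replace :: "fm \<Rightarrow> nat \<Rightarrow> fm \<Rightarrow> fm" where
  "replace \<gamma> p \<alpha> = subst (Var(p := \<alpha>)) \<gamma>"


inductive_set mbC_axioms :: "fm set" where
  Ax1: "\<alpha> \<^bold>\<rightarrow> (\<beta> \<^bold>\<rightarrow> \<alpha>) \<in> mbC_axioms"
| Ax2: "(\<alpha> \<^bold>\<rightarrow> (\<beta> \<^bold>\<rightarrow> \<gamma>)) \<^bold>\<rightarrow> ((\<alpha> \<^bold>\<rightarrow> \<beta>) \<^bold>\<rightarrow> (\<alpha> \<^bold>\<rightarrow> \<gamma>)) \<in> mbC_axioms"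
| Ax3: "\<alpha> \<^bold>\<rightarrow> (\<beta> \<^bold>\<rightarrow> (\<alpha> \<^bold>\<and> \<beta>)) \<in> mbC_axioms"
| Ax4: "(\<alpha> \<^bold>\<and> \<beta>) \<^bold>\<rightarrow> \<alpha> \<in> mbC_axioms"
| Ax5: "(\<alpha> \<^bold>\<and> \<beta>) \<^bold>\<rightarrow> \<beta> \<in> mbC_axioms"
| Ax6: "\<alpha> \<^bold>\<rightarrow> (\<alpha> \<^bold>\<or> \<beta>) \<in> mbC_axioms"
| Ax7: "\<beta> \<^bold>\<rightarrow> (\<alpha> \<^bold>\<or> \<beta>) \<in> mbC_axioms"
| Ax8: "(\<alpha> \<^bold>\<rightarrow> \<gamma>) \<^bold>\<rightarrow> ((\<beta> \<^bold>\<rightarrow> \<gamma>) \<^bold>\<rightarrow> ((\<alpha> \<^bold>\<or> \<beta>) \<^bold>\<rightarrow> \<gamma>)) \<in> mbC_axioms"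
| Ax9: "(\<alpha> \<^bold>\<rightarrow> \<beta>) \<^bold>\<or> \<alpha> \<in> mbC_axioms"
| Ax10: "\<alpha> \<^bold>\<or> (\<^bold>\<not> \<alpha>) \<in> mbC_axioms"
| bc1: "(\<^bold>\<circ> \<alpha>) \<^bold>\<rightarrow> (\<alpha> \<^bold>\<rightarrow> ((\<^bold>\<not> \<alpha>) \<^bold>\<rightarrow> \<beta>)) \<in> mbC_axioms"

definition cf_axioms :: "fm set" where
  "cf_axioms = {(\<^bold>\<not> (\<^bold>\<not> \<alpha>)) \<^bold>\<rightarrow> \<alpha> | \<alpha>. True}"

text \<open>A rule is the set of its instances (premises, conclusion).\<close>

type_synonym rule = "(fm set \<times> fm) set"

definition MP :: rule where
  "MP = {({\<alpha>, \<alpha> \<^bold>\<rightarrow> \<beta>}, \<beta>) | \<alpha> \<beta>. True}"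

definition R_neg :: rule where
  "R_neg = {({\<alpha> \<^bold>\<leftrightarrow> \<beta>}, (\<^bold>\<not> \<alpha>) \<^bold>\<leftrightarrow> (\<^bold>\<not> \<beta>)) | \<alpha> \<beta>. True}"

definition R_circ :: rule where
  "R_circ = {({\<alpha> \<^bold>\<leftrightarrow> \<beta>}, (\<^bold>\<circ> \<alpha>) \<^bold>\<leftrightarrow> (\<^bold>\<circ> \<beta>)) | \<alpha> \<beta>. True}"

definition is_derivation :: "fm set \<Rightarrow> rule \<Rightarrow> fm list \<Rightarrow> bool" where
  "is_derivation A R \<delta>s \<longleftrightarrow>
     (\<forall>i < length \<delta>s. \<delta>s ! i \<in> A \<or> (\<exists>P. (P, \<delta>s ! i) \<in> R \<and> P \<subseteq> set (take i \<delta>s)))"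

definition derivable :: "fm set \<Rightarrow> rule \<Rightarrow> fm \<Rightarrow> bool" where
  "derivable A R \<phi> \<longleftrightarrow> (\<exists>\<delta>s. \<delta>s \<noteq> [] \<and> is_derivation A R \<delta>s \<and> last \<delta>s = \<phi>)"

definition bC_consequence :: "fm set \<Rightarrow> fm \<Rightarrow> bool" (infix \<open>\<turnstile>\<^sub>b\<^sub>C\<close> 55) where
  "\<Gamma> \<turnstile>\<^sub>b\<^sub>C \<phi> \<longleftrightarrow> derivable (mbC_axioms \<union> cf_axioms \<union> \<Gamma>) MP \<phi>"


text \<open>
  The rules \<open>R_neg\<close> and \<open>R_circ\<close> are global: they may be applied to theorems only, so
  premises do not enter derivations but only the implication proved as a theorem.
\<close>

definition RmbC_rules :: rule where
  "RmbC_rules = MP \<union> R_neg \<union> R_circ"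

definition RbC_theorem :: "fm \<Rightarrow> bool" where
  "RbC_theorem \<phi> \<longleftrightarrow> derivable (mbC_axioms \<union> cf_axioms) RmbC_rules \<phi>"

text \<open>For a nonempty list, the conjunction of its members nested to the right.\<close>

definition conj_list :: "fm list \<Rightarrow> fm" where
  "conj_list \<gamma>s = foldr Conj (butlast \<gamma>s) (last \<gamma>s)"

definition RbC_consequence :: "fm set \<Rightarrow> fm \<Rightarrow> bool" (infix \<open>\<turnstile>\<^sub>R\<^sub>b\<^sub>C\<close> 55) where
  "\<Gamma> \<turnstile>\<^sub>R\<^sub>b\<^sub>C \<phi> \<longleftrightarrow>
     RbC_theorem \<phi> \<or>
     (\<exists>\<gamma>s. \<gamma>s \<noteq> [] \<and> set \<gamma>s \<subseteq> \<Gamma> \<and> RbC_theorem (conj_list \<gamma>s \<^bold>\<rightarrow> \<phi>))"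


definition replacement_property :: "(fm \<Rightarrow> bool) \<Rightarrow> bool" where
  "replacement_property thm \<longleftrightarrow>
     (\<forall>\<alpha> \<beta>. thm (\<alpha> \<^bold>\<leftrightarrow> \<beta>) \<longrightarrow> (\<forall>\<gamma> p. thm (replace \<gamma> p \<alpha> \<^bold>\<leftrightarrow> replace \<gamma> p \<beta>)))"

definition tarskian :: "(fm set \<Rightarrow> fm \<Rightarrow> bool) \<Rightarrow> bool" where
  "tarskian C \<longleftrightarrow>
     (\<forall>\<Gamma> \<phi>. \<phi> \<in> \<Gamma> \<longrightarrow> C \<Gamma> \<phi>) \<and>
     (\<forall>\<Gamma> \<Delta> \<phi>. C \<Gamma> \<phi> \<longrightarrow> \<Gamma> \<subseteq> \<Delta> \<longrightarrow> C \<Delta> \<phi>) \<and>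
     (\<forall>\<Gamma> \<Delta> \<phi>. C \<Delta> \<phi> \<longrightarrow> (\<forall>\<delta>\<in>\<Delta>. C \<Gamma> \<delta>) \<longrightarrow> C \<Gamma> \<phi>)"

definition finitary :: "(fm set \<Rightarrow> fm \<Rightarrow> bool) \<Rightarrow> bool" where
  "finitary C \<longleftrightarrow> (\<forall>\<Gamma> \<phi>. C \<Gamma> \<phi> \<longrightarrow> (\<exists>\<Gamma>\<^sub>0. finite \<Gamma>\<^sub>0 \<and> \<Gamma>\<^sub>0 \<subseteq> \<Gamma> \<and> C \<Gamma>\<^sub>0 \<phi>))"

definition structural :: "(fm set \<Rightarrow> fm \<Rightarrow> bool) \<Rightarrow> bool" where
  "structural C \<longleftrightarrow> (\<forall>\<Gamma> \<phi> \<sigma>. C \<Gamma> \<phi> \<longrightarrow> C (subst \<sigma> ` \<Gamma>) (subst \<sigma> \<phi>))"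

definition paraconsistent :: "(fm set \<Rightarrow> fm \<Rightarrow> bool) \<Rightarrow> bool" where
  "paraconsistent C \<longleftrightarrow> (\<exists>\<phi> \<psi>. \<not> C {\<phi>, \<^bold>\<not> \<phi>} \<psi>)"

definition LFI :: "(fm set \<Rightarrow> fm \<Rightarrow> bool) \<Rightarrow> bool" where
  "LFI C \<longleftrightarrow>
     tarskian C \<and> finitary C \<and> structural C \<and>
     (\<exists>\<phi> \<psi>. \<not> C {\<phi>, \<^bold>\<not> \<phi>} \<psi>) \<and>
     (\<forall>\<phi> \<psi>. C {\<^bold>\<circ> \<phi>, \<phi>, \<^bold>\<not> \<phi>} \<psi>) \<and>
     (\<exists>\<alpha> \<beta>. \<not> C {\<^bold>\<circ> \<alpha>, \<alpha>} \<beta> \<and> \<not> C {\<^bold>\<circ> \<alpha>, \<^bold>\<not> \<alpha>} \<beta>)"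

end

(* The local consequence relation becomes tractable once premise conjunctions are curried:
   the set of formulas following from given premises is then visibly closed under modus ponens,
   which yields the extension of bC and transitivity. Non-derivability is shown in the
   four-element Boolean algebra, with the negation sending the top element to the bottom and
   everything else to the top: at an atom, a formula and its negation are jointly consistent. *)

theory Submission
  imports Defs
begin

section \<open>Derivations\<close>

text \<open>Replaces reasoning about sequences by rule induction. The premises of a rule application
  lie strictly earlier in the sequence, so strong induction on the position suffices.\<close>

lemma derivable_induct [consumes 1, case_names ax rule]:
  assumes "derivable A R \<phi>"
    and ax: "\<And>\<alpha>. \<alpha> \<in> A \<Longrightarrow> P \<alpha>"
    and rule: "\<And>Q \<alpha>. (Q, \<alpha>) \<in> R \<Longrightarrow> (\<And>\<beta>. \<beta> \<in> Q \<Longrightarrow> P \<beta>) \<Longrightarrow> P \<alpha>"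
  shows "P \<phi>"
proof -
  from assms(1) obtain \<delta>s where \<delta>s: "\<delta>s \<noteq> []" "is_derivation A R \<delta>s" "last \<delta>s = \<phi>"
    by (auto simp: derivable_def)
  have "i < length \<delta>s \<Longrightarrow> P (\<delta>s ! i)" for i
  proof (induction i rule: less_induct)
    case (less i)
    from \<delta>s(2) less.prems consider "\<delta>s ! i \<in> A"
      | Q where "(Q, \<delta>s ! i) \<in> R" "Q \<subseteq> set (take i \<delta>s)"
      by (auto simp: is_derivation_def)
    then show ?case
    proof cases
      case 1
      then show ?thesis by (rule ax)
    next
      case 2
      have "P \<beta>" if "\<beta> \<in> Q" for \<beta>
      proof -
        from that 2(2) have "\<beta> \<in> set (take i \<delta>s)" by blast
        then obtain j where "j < i" "j < length \<delta>s" "\<delta>s ! j = \<beta>"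
          by (auto simp: in_set_conv_nth)
        then show ?thesis using less.IH by blast
      qed
      then show ?thesis using 2(1) rule by blast
    qed
  qed
  then show ?thesis
    using \<delta>s(1,3) by (auto simp: last_conv_nth)
qed

lemma derivable_axiom:
  assumes "\<phi> \<in> A"
  shows "derivable A R \<phi>"
  unfolding derivable_def
  by (rule exI [of _ "[\<phi>]"]) (simp add: is_derivation_def assms)

text \<open>Rule applications in \<open>ys\<close> survive the shift: the prefix available to them
  still contains the corresponding prefix of \<open>ys\<close>, together with all of
  \<open>xs\<close>.\<close>

lemma is_derivation_append:
  assumes "is_derivation A R xs" "is_derivation A R ys"
  shows "is_derivation A R (xs @ ys)"
  unfolding is_derivation_def
proof (intro allI impI)
  fix i assume i: "i < length (xs @ ys)"
  show "(xs @ ys) ! i \<in> A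
    \<or> (\<exists>Q. (Q, (xs @ ys) ! i) \<in> R \<and> Q \<subseteq> set (take i (xs @ ys)))"
  proof (cases "i < length xs")
    case True
    then show ?thesis
      using assms(1) by (auto simp: is_derivation_def nth_append)
  next
    case False
    then have "i - length xs < length ys" using i by simp
    then have "ys ! (i - length xs) \<in> A
      \<or> (\<exists>Q. (Q, ys ! (i - length xs)) \<in> R \<and> Q \<subseteq> set (take (i - length xs) ys))"
      using assms(2) by (auto simp: is_derivation_def)
    then show ?thesis using False by (auto simp: nth_append)
  qed
qed

text \<open>Finiteness of \<open>Q\<close> lets the derivations of its members be concatenated into
  one sequence, to which the conclusion is then appended.\<close>

lemma derivable_rule:
  assumes "(Q, \<phi>) \<in> R" "finite Q" and Q: "\<And>\<beta>. \<beta> \<in> Q \<Longrightarrow> derivable A R \<beta>"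
  shows "derivable A R \<phi>"
proof -
  have "\<exists>\<delta>s. is_derivation A R \<delta>s \<and> Q \<subseteq> set \<delta>s"
    using assms(2) Q
  proof (induction Q rule: finite_induct)
    case empty
    show ?case by (rule exI [of _ "[]"]) (simp add: is_derivation_def)
  next
    case (insert \<beta> Q)
    then obtain \<delta>s where \<delta>s: "is_derivation A R \<delta>s" "Q \<subseteq> set \<delta>s" by blast
    from insert.prems obtain \<epsilon>s where "\<epsilon>s \<noteq> []" "is_derivation A R \<epsilon>s" "last \<epsilon>s = \<beta>"
      unfolding derivable_def by blast
    with \<delta>s show ?case
      by (intro exI [of _ "\<delta>s @ \<epsilon>s"]) (auto simp: is_derivation_append)
  qed
  then obtain \<delta>s where \<delta>s: "is_derivation A R \<delta>s" "Q \<subseteq> set \<delta>s" by blast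
  then have "is_derivation A R (\<delta>s @ [\<phi>])"
    using assms(1) by (auto simp: is_derivation_def nth_append less_Suc_eq)
  then show ?thesis
    unfolding derivable_def by (intro exI [of _ "\<delta>s @ [\<phi>]"]) simp
qed

section \<open>Theorems of RbC\<close>

lemma RbC_theorem_induct [consumes 1, case_names mbC cf MP R_neg R_circ]:
  assumes "RbC_theorem \<phi>"
    and "\<And>\<alpha>. \<alpha> \<in> mbC_axioms \<Longrightarrow> P \<alpha>"
    and "\<And>\<alpha>. P (\<^bold>\<not> \<^bold>\<not> \<alpha> \<^bold>\<rightarrow> \<alpha>)"
    and "\<And>\<alpha> \<beta>. P \<alpha> \<Longrightarrow> P (\<alpha> \<^bold>\<rightarrow> \<beta>) \<Longrightarrow> P \<beta>"
    and "\<And>\<alpha> \<beta>. P (\<alpha> \<^bold>\<leftrightarrow> \<beta>) \<Longrightarrow> P ((\<^bold>\<not> \<alpha>) \<^bold>\<leftrightarrow> (\<^bold>\<not> \<beta>))"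
    and "\<And>\<alpha> \<beta>. P (\<alpha> \<^bold>\<leftrightarrow> \<beta>) \<Longrightarrow> P ((\<^bold>\<circ> \<alpha>) \<^bold>\<leftrightarrow> (\<^bold>\<circ> \<beta>))"
  shows "P \<phi>"
  using assms(1) unfolding RbC_theorem_def
proof (induction rule: derivable_induct)
  case (ax \<alpha>)
  then show ?case using assms(2,3) by (auto simp: cf_axioms_def)
next
  case (rule Q \<alpha>)
  then consider \<beta> where "Q = {\<beta>, \<beta> \<^bold>\<rightarrow> \<alpha>}"
    | \<beta> \<gamma> where "Q = {\<beta> \<^bold>\<leftrightarrow> \<gamma>}" "\<alpha> = (\<^bold>\<not> \<beta>) \<^bold>\<leftrightarrow> (\<^bold>\<not> \<gamma>)"
    | \<beta> \<gamma> where "Q = {\<beta> \<^bold>\<leftrightarrow> \<gamma>}" "\<alpha> = (\<^bold>\<circ> \<beta>) \<^bold>\<leftrightarrow> (\<^bold>\<circ> \<gamma>)"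
    by (auto simp: RmbC_rules_def MP_def R_neg_def R_circ_def)
  then show ?case
  proof cases
    case 1
    then show ?thesis using rule.IH assms(4) [of \<beta> \<alpha>] by simp
  next
    case 2
    then show ?thesis using rule.IH assms(5) [of \<beta> \<gamma>] by simp
  next
    case 3
    then show ?thesis using rule.IH assms(6) [of \<beta> \<gamma>] by simp
  qed
qed

lemma RbC_axiom: "\<alpha> \<in> mbC_axioms \<Longrightarrow> RbC_theorem \<alpha>"
  by (simp add: RbC_theorem_def derivable_axiom)

lemma RbC_cf: "RbC_theorem (\<^bold>\<not> \<^bold>\<not> \<alpha> \<^bold>\<rightarrow> \<alpha>)"
  by (auto simp: RbC_theorem_def cf_axioms_def intro!: derivable_axiom)

lemma RbC_MP: "RbC_theorem (\<alpha> \<^bold>\<rightarrow> \<beta>) \<Longrightarrow> RbC_theorem \<alpha> \<Longrightarrow> RbC_theorem \<beta>"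
  unfolding RbC_theorem_def
  by (rule derivable_rule [of "{\<alpha>, \<alpha> \<^bold>\<rightarrow> \<beta>}"]) (auto simp: RmbC_rules_def MP_def)

lemma RbC_R_neg: "RbC_theorem (\<alpha> \<^bold>\<leftrightarrow> \<beta>) \<Longrightarrow> RbC_theorem ((\<^bold>\<not> \<alpha>) \<^bold>\<leftrightarrow> (\<^bold>\<not> \<beta>))"
  unfolding RbC_theorem_def
  by (rule derivable_rule [of "{\<alpha> \<^bold>\<leftrightarrow> \<beta>}"]) (auto simp: RmbC_rules_def R_neg_def)

lemma RbC_R_circ: "RbC_theorem (\<alpha> \<^bold>\<leftrightarrow> \<beta>) \<Longrightarrow> RbC_theorem ((\<^bold>\<circ> \<alpha>) \<^bold>\<leftrightarrow> (\<^bold>\<circ> \<beta>))"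
  unfolding RbC_theorem_def
  by (rule derivable_rule [of "{\<alpha> \<^bold>\<leftrightarrow> \<beta>}"]) (auto simp: RmbC_rules_def R_circ_def)

section \<open>Derived rules of positive propositional logic\<close>

lemma RbC_imp_const: "RbC_theorem \<alpha> \<Longrightarrow> RbC_theorem (\<beta> \<^bold>\<rightarrow> \<alpha>)"
  by (rule RbC_MP [OF RbC_axiom [OF Ax1]])

lemma RbC_imp_MP:
  "RbC_theorem (\<alpha> \<^bold>\<rightarrow> (\<beta> \<^bold>\<rightarrow> \<gamma>)) \<Longrightarrow> RbC_theorem (\<alpha> \<^bold>\<rightarrow> \<beta>) \<Longrightarrow> RbC_theorem (\<alpha> \<^bold>\<rightarrow> \<gamma>)"
  by (rule RbC_MP [OF RbC_MP [OF RbC_axiom [OF Ax2]]])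

lemma RbC_imp_trans:
  "RbC_theorem (\<alpha> \<^bold>\<rightarrow> \<beta>) \<Longrightarrow> RbC_theorem (\<beta> \<^bold>\<rightarrow> \<gamma>) \<Longrightarrow> RbC_theorem (\<alpha> \<^bold>\<rightarrow> \<gamma>)"
  by (rule RbC_imp_MP [OF RbC_imp_const])

lemma RbC_imp_refl: "RbC_theorem (\<alpha> \<^bold>\<rightarrow> \<alpha>)"
  by (rule RbC_imp_MP [OF RbC_axiom [OF Ax1] RbC_axiom [OF Ax1]])

lemma RbC_imp_monoR:
  assumes "RbC_theorem (\<alpha> \<^bold>\<rightarrow> \<beta>)"
  shows "RbC_theorem ((\<gamma> \<^bold>\<rightarrow> \<alpha>) \<^bold>\<rightarrow> (\<gamma> \<^bold>\<rightarrow> \<beta>))"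
  by (rule RbC_MP [OF RbC_axiom [OF Ax2] RbC_imp_const [OF assms]])

lemma RbC_imp_monoL:
  assumes "RbC_theorem (\<alpha> \<^bold>\<rightarrow> \<beta>)"
  shows "RbC_theorem ((\<beta> \<^bold>\<rightarrow> \<gamma>) \<^bold>\<rightarrow> (\<alpha> \<^bold>\<rightarrow> \<gamma>))"
  \<comment> \<open>Ax1 and Ax2 compose to \<open>(\<beta> \<rightarrow> \<gamma>) \<rightarrow>
    ((\<alpha> \<rightarrow> \<beta>) \<rightarrow> (\<alpha> \<rightarrow> \<gamma>))\<close>,
    whose middle antecedent is the assumed theorem.\<close>
  by (rule RbC_imp_MP [OF RbC_imp_trans [OF RbC_axiom [OF Ax1] RbC_axiom [OF Ax2]]
        RbC_imp_const [OF assms]])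

lemma RbC_imp_mono:
  assumes "RbC_theorem (\<alpha>' \<^bold>\<rightarrow> \<alpha>)" "RbC_theorem (\<beta> \<^bold>\<rightarrow> \<beta>')"
  shows "RbC_theorem ((\<alpha> \<^bold>\<rightarrow> \<beta>) \<^bold>\<rightarrow> (\<alpha>' \<^bold>\<rightarrow> \<beta>'))"
  by (rule RbC_imp_trans [OF RbC_imp_monoL [OF assms(1)] RbC_imp_monoR [OF assms(2)]])

lemma RbC_conjI: "RbC_theorem \<alpha> \<Longrightarrow> RbC_theorem \<beta> \<Longrightarrow> RbC_theorem (\<alpha> \<^bold>\<and> \<beta>)"
  by (rule RbC_MP [OF RbC_MP [OF RbC_axiom [OF Ax3]]])

lemma RbC_imp_conjI:
  assumes "RbC_theorem (\<gamma> \<^bold>\<rightarrow> \<alpha>)" "RbC_theorem (\<gamma> \<^bold>\<rightarrow> \<beta>)"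
  shows "RbC_theorem (\<gamma> \<^bold>\<rightarrow> \<alpha> \<^bold>\<and> \<beta>)"
  by (rule RbC_imp_MP [OF RbC_imp_trans [OF assms(1) RbC_axiom [OF Ax3]] assms(2)])

lemma RbC_conj_mono:
  assumes "RbC_theorem (\<alpha> \<^bold>\<rightarrow> \<alpha>')" "RbC_theorem (\<beta> \<^bold>\<rightarrow> \<beta>')"
  shows "RbC_theorem (\<alpha> \<^bold>\<and> \<beta> \<^bold>\<rightarrow> \<alpha>' \<^bold>\<and> \<beta>')"
  by (intro RbC_imp_conjI RbC_imp_trans [OF RbC_axiom [OF Ax4] assms(1)]
      RbC_imp_trans [OF RbC_axiom [OF Ax5] assms(2)])

lemma RbC_disj_mono:
  assumes "RbC_theorem (\<alpha> \<^bold>\<rightarrow> \<alpha>')" "RbC_theorem (\<beta> \<^bold>\<rightarrow> \<beta>')"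
  shows "RbC_theorem (\<alpha> \<^bold>\<or> \<beta> \<^bold>\<rightarrow> \<alpha>' \<^bold>\<or> \<beta>')"
  by (rule RbC_MP [OF RbC_MP [OF RbC_axiom [OF Ax8]]];
      rule RbC_imp_trans [OF assms(1) RbC_axiom [OF Ax6]]
        RbC_imp_trans [OF assms(2) RbC_axiom [OF Ax7]])

lemma RbC_iff: "RbC_theorem (\<alpha> \<^bold>\<leftrightarrow> \<beta>) \<longleftrightarrow> RbC_theorem (\<alpha> \<^bold>\<rightarrow> \<beta>) \<and> RbC_theorem (\<beta> \<^bold>\<rightarrow> \<alpha>)"
  using RbC_MP [OF RbC_axiom [OF Ax4]] RbC_MP [OF RbC_axiom [OF Ax5]] RbC_conjI by blast

lemma RbC_curry: "RbC_theorem ((\<alpha> \<^bold>\<and> \<beta> \<^bold>\<rightarrow> \<gamma>) \<^bold>\<rightarrow> (\<alpha> \<^bold>\<rightarrow> (\<beta> \<^bold>\<rightarrow> \<gamma>)))"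
proof -
  have "RbC_theorem ((\<alpha> \<^bold>\<and> \<beta> \<^bold>\<rightarrow> \<gamma>) \<^bold>\<rightarrow> ((\<beta> \<^bold>\<rightarrow> \<alpha> \<^bold>\<and> \<beta>) \<^bold>\<rightarrow> (\<beta> \<^bold>\<rightarrow> \<gamma>)))"
    by (rule RbC_imp_trans [OF RbC_axiom [OF Ax1] RbC_axiom [OF Ax2]])
  \<comment> \<open>By Ax3, \<open>\<alpha>\<close> implies the middle antecedent
    \<open>\<beta> \<rightarrow> \<alpha> \<and> \<beta>\<close>, so \<open>\<alpha>\<close> may
    take its place.\<close>
  then show ?thesis
    by (rule RbC_imp_trans [OF _ RbC_imp_monoL [OF RbC_axiom [OF Ax3]]])
qed

lemma RbC_uncurry: "RbC_theorem ((\<alpha> \<^bold>\<rightarrow> (\<beta> \<^bold>\<rightarrow> \<gamma>)) \<^bold>\<rightarrow> (\<alpha> \<^bold>\<and> \<beta> \<^bold>\<rightarrow> \<gamma>))"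
  by (rule RbC_imp_MP [OF RbC_imp_trans [OF RbC_imp_monoL [OF RbC_axiom [OF Ax4]]
          RbC_axiom [OF Ax2]] RbC_imp_const [OF RbC_axiom [OF Ax5]]])

section \<open>Replacement and closure under substitution\<close>

lemma RbC_replacement: "replacement_property RbC_theorem"
  unfolding replacement_property_def
proof (intro allI impI)
  fix \<alpha> \<beta> \<gamma> p
  assume "RbC_theorem (\<alpha> \<^bold>\<leftrightarrow> \<beta>)"
  then show "RbC_theorem (replace \<gamma> p \<alpha> \<^bold>\<leftrightarrow> replace \<gamma> p \<beta>)"
  \<comment> \<open>The two added rules settle exactly the unary connectives. The binary ones follow
    from monotonicity, where implication, being antitone on the left, uses both directions of the
    induction hypothesis.\<close>
  proof (induction \<gamma>)
    case (Var q)
    then show ?case by (simp add: replace_def RbC_iff RbC_imp_refl)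
  next
    case (Neg \<gamma>)
    then show ?case by (simp add: replace_def RbC_R_neg)
  next
    case (Circ \<gamma>)
    then show ?case by (simp add: replace_def RbC_R_circ)
  qed (simp_all add: replace_def RbC_iff RbC_conj_mono RbC_disj_mono RbC_imp_mono)
qed

lemma subst_mbC_axioms: "\<alpha> \<in> mbC_axioms \<Longrightarrow> subst \<sigma> \<alpha> \<in> mbC_axioms"
  by (induction rule: mbC_axioms.induct) (auto intro: mbC_axioms.intros)

lemma RbC_theorem_subst: "RbC_theorem \<phi> \<Longrightarrow> RbC_theorem (subst \<sigma> \<phi>)"
proof (induction rule: RbC_theorem_induct)
  case (mbC \<alpha>)
  then show ?case by (intro RbC_axiom subst_mbC_axioms)
next
  case (MP \<alpha> \<beta>)
  from RbC_MP [OF _ MP(1)] MP(2) show ?case by simp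
qed (simp_all add: RbC_cf RbC_R_neg RbC_R_circ)

section \<open>The consequence relation\<close>

lemma conj_list_Cons: "\<gamma>s \<noteq> [] \<Longrightarrow> conj_list (\<gamma> # \<gamma>s) = \<gamma> \<^bold>\<and> conj_list \<gamma>s"
  by (simp add: conj_list_def)

text \<open>Both sides nest to the right, so each further premise costs one currying in one
  direction and one uncurrying in the other. The empty list is excluded because
  \<open>conj_list []\<close> is the unspecified \<open>last []\<close>.\<close>

lemma RbC_conj_list_imp:
  assumes "\<gamma>s \<noteq> []"
  shows "RbC_theorem ((conj_list \<gamma>s \<^bold>\<rightarrow> \<phi>) \<^bold>\<leftrightarrow> foldr Imp \<gamma>s \<phi>)"
  using assms
proof (induction \<gamma>s rule: list_nonempty_induct)
  case (single \<gamma>)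
  then show ?case by (simp add: conj_list_def RbC_iff RbC_imp_refl)
next
  case (cons \<gamma> \<gamma>s)
  then show ?case
    unfolding conj_list_Cons [OF cons.hyps] RbC_iff foldr_Cons o_apply
    using RbC_imp_trans [OF RbC_curry RbC_imp_monoR] RbC_imp_trans [OF RbC_imp_monoR RbC_uncurry]
    by blast
qed

text \<open>The curried form absorbs the separate clause for theorems: it becomes the case of the
  empty list, so later arguments need no case distinction.\<close>

lemma RbC_consequence_iff:
  "\<Gamma> \<turnstile>\<^sub>R\<^sub>b\<^sub>C \<phi> \<longleftrightarrow> (\<exists>\<gamma>s. set \<gamma>s \<subseteq> \<Gamma> \<and> RbC_theorem (foldr Imp \<gamma>s \<phi>))"
proof -
  have "RbC_theorem (conj_list \<gamma>s \<^bold>\<rightarrow> \<phi>) \<longleftrightarrow> RbC_theorem (foldr Imp \<gamma>s \<phi>)"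
    if "\<gamma>s \<noteq> []" for \<gamma>s
    using RbC_conj_list_imp [OF that, of \<phi>] RbC_MP unfolding RbC_iff by blast
  moreover have "RbC_theorem \<phi> \<longleftrightarrow> RbC_theorem (foldr Imp [] \<phi>)"
    by simp
  ultimately show ?thesis
    unfolding RbC_consequence_def by (metis empty_set empty_subsetI)
qed

lemma RbC_foldr_Imp_mono:
  "RbC_theorem (\<phi> \<^bold>\<rightarrow> \<psi>) \<Longrightarrow> RbC_theorem (foldr Imp \<gamma>s \<phi> \<^bold>\<rightarrow> foldr Imp \<gamma>s \<psi>)"
  by (induction \<gamma>s) (simp_all add: RbC_imp_monoR)

lemma RbC_foldr_Imp_weaken: "RbC_theorem (\<phi> \<^bold>\<rightarrow> foldr Imp \<gamma>s \<phi>)"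
proof (induction \<gamma>s)
  case Nil
  show ?case by (simp add: RbC_imp_refl)
next
  case (Cons \<gamma> \<gamma>s)
  show ?case
    using RbC_imp_trans [OF Cons.IH RbC_axiom [OF Ax1]] by simp
qed

text \<open>Ax2 with its single antecedent generalised to a list of premises; this is what makes
  modus ponens work under shared premises.\<close>

lemma RbC_foldr_Imp_distrib:
  "RbC_theorem (foldr Imp \<gamma>s (\<phi> \<^bold>\<rightarrow> \<psi>) \<^bold>\<rightarrow> (foldr Imp \<gamma>s \<phi> \<^bold>\<rightarrow> foldr Imp \<gamma>s \<psi>))"
proof (induction \<gamma>s)
  case Nil
  show ?case by (simp add: RbC_imp_refl)
next
  case (Cons \<gamma> \<gamma>s)
  show ?case
    using RbC_imp_trans [OF RbC_imp_monoR [OF Cons.IH] RbC_axiom [OF Ax2]] by simp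
qed

lemma RbC_consequence_theorem: "RbC_theorem \<phi> \<Longrightarrow> \<Gamma> \<turnstile>\<^sub>R\<^sub>b\<^sub>C \<phi>"
  by (simp add: RbC_consequence_def)

lemma RbC_consequence_refl: "\<phi> \<in> \<Gamma> \<Longrightarrow> \<Gamma> \<turnstile>\<^sub>R\<^sub>b\<^sub>C \<phi>"
  unfolding RbC_consequence_iff
  by (rule exI [of _ "[\<phi>]"]) (simp add: RbC_imp_refl)

lemma RbC_consequence_mono: "\<Gamma> \<turnstile>\<^sub>R\<^sub>b\<^sub>C \<phi> \<Longrightarrow> \<Gamma> \<subseteq> \<Delta> \<Longrightarrow> \<Delta> \<turnstile>\<^sub>R\<^sub>b\<^sub>C \<phi>"
  unfolding RbC_consequence_iff by blast

lemma RbC_consequence_MP: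
  assumes "\<Gamma> \<turnstile>\<^sub>R\<^sub>b\<^sub>C \<phi> \<^bold>\<rightarrow> \<psi>" "\<Gamma> \<turnstile>\<^sub>R\<^sub>b\<^sub>C \<phi>"
  shows "\<Gamma> \<turnstile>\<^sub>R\<^sub>b\<^sub>C \<psi>"
proof -
  from assms obtain \<gamma>s \<delta>s where \<gamma>s: "set \<gamma>s \<subseteq> \<Gamma>" "RbC_theorem (foldr Imp \<gamma>s (\<phi> \<^bold>\<rightarrow> \<psi>))"
    and \<delta>s: "set \<delta>s \<subseteq> \<Gamma>" "RbC_theorem (foldr Imp \<delta>s \<phi>)"
    unfolding RbC_consequence_iff by blast
  \<comment> \<open>Both premises are brought to the common list
    \<open>\<gamma>s @ \<delta>s\<close>: here \<open>\<delta>s\<close> is inserted beneath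
    \<open>\<gamma>s\<close>, and for \<open>\<phi>\<close> the list \<open>\<gamma>s\<close> is put
    in front.\<close>
  have "RbC_theorem (foldr Imp (\<gamma>s @ \<delta>s) (\<phi> \<^bold>\<rightarrow> \<psi>))"
    using RbC_MP [OF RbC_foldr_Imp_mono [OF RbC_foldr_Imp_weaken] \<gamma>s(2)] by simp
  moreover have "RbC_theorem (foldr Imp (\<gamma>s @ \<delta>s) \<phi>)"
    using RbC_MP [OF RbC_foldr_Imp_weaken \<delta>s(2)] by simp
  ultimately have "RbC_theorem (foldr Imp (\<gamma>s @ \<delta>s) \<psi>)"
    using RbC_MP RbC_foldr_Imp_distrib by blast
  then show ?thesis
    unfolding RbC_consequence_iff using \<gamma>s(1) \<delta>s(1)
    by (intro exI [of _ "\<gamma>s @ \<delta>s"]) simp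
qed

text \<open>Cut for a list of premises, discharged one at a time by modus ponens; transitivity rests
  on it.\<close>

lemma RbC_consequence_foldr_Imp:
  "\<Gamma> \<turnstile>\<^sub>R\<^sub>b\<^sub>C foldr Imp \<delta>s \<phi> \<Longrightarrow> (\<And>\<delta>. \<delta> \<in> set \<delta>s \<Longrightarrow> \<Gamma> \<turnstile>\<^sub>R\<^sub>b\<^sub>C \<delta>) \<Longrightarrow> \<Gamma> \<turnstile>\<^sub>R\<^sub>b\<^sub>C \<phi>"
  by (induction \<delta>s) (auto dest: RbC_consequence_MP)

text \<open>In bC the premises act as axioms of the derivation and modus ponens is the only rule, so
  closure of the local consequence under modus ponens suffices.\<close>

lemma bC_consequence_imp_RbC_consequence: "\<Gamma> \<turnstile>\<^sub>b\<^sub>C \<phi> \<Longrightarrow> \<Gamma> \<turnstile>\<^sub>R\<^sub>b\<^sub>C \<phi>"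
  unfolding bC_consequence_def
proof (induction rule: derivable_induct)
  case (ax \<alpha>)
  then show ?case
    by (auto simp: cf_axioms_def
        intro: RbC_consequence_refl RbC_consequence_theorem RbC_axiom RbC_cf)
next
  case (rule Q \<alpha>)
  then show ?case by (auto simp: MP_def intro: RbC_consequence_MP)
qed

section \<open>Structural properties of the consequence relation\<close>

lemma RbC_tarskian: "tarskian RbC_consequence"
proof -
  have "\<Gamma> \<turnstile>\<^sub>R\<^sub>b\<^sub>C \<phi>" if "\<Delta> \<turnstile>\<^sub>R\<^sub>b\<^sub>C \<phi>" "\<forall>\<delta>\<in>\<Delta>. \<Gamma> \<turnstile>\<^sub>R\<^sub>b\<^sub>C \<delta>" for \<Gamma> \<Delta> \<phi>
  proof -
    from that(1) obtain \<delta>s where "set \<delta>s \<subseteq> \<Delta>" "RbC_theorem (foldr Imp \<delta>s \<phi>)"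
      unfolding RbC_consequence_iff by blast
    with that(2) show ?thesis
      by (blast intro: RbC_consequence_foldr_Imp RbC_consequence_theorem)
  qed
  then show ?thesis
    unfolding tarskian_def using RbC_consequence_refl RbC_consequence_mono by blast
qed

lemma RbC_finitary: "finitary RbC_consequence"
  \<comment> \<open>The finite subset is the set of members of the witnessing list.\<close>
  unfolding finitary_def RbC_consequence_iff by (meson List.finite_set subset_refl)

lemma RbC_structural: "structural RbC_consequence"
  unfolding structural_def
proof (intro allI impI)
  fix \<Gamma> \<phi> \<sigma>
  assume "\<Gamma> \<turnstile>\<^sub>R\<^sub>b\<^sub>C \<phi>"
  then obtain \<gamma>s where \<gamma>s: "set \<gamma>s \<subseteq> \<Gamma>" "RbC_theorem (foldr Imp \<gamma>s \<phi>)"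
    unfolding RbC_consequence_iff by blast
  have "subst \<sigma> (foldr Imp \<gamma>s \<phi>) = foldr Imp (map (subst \<sigma>) \<gamma>s) (subst \<sigma> \<phi>)"
    by (induction \<gamma>s) simp_all
  then have "RbC_theorem (foldr Imp (map (subst \<sigma>) \<gamma>s) (subst \<sigma> \<phi>))"
    using RbC_theorem_subst [OF \<gamma>s(2), of \<sigma>] by simp
  then show "subst \<sigma> ` \<Gamma> \<turnstile>\<^sub>R\<^sub>b\<^sub>C subst \<sigma> \<phi>"
    unfolding RbC_consequence_iff using \<gamma>s(1)
    by (intro exI [of _ "map (subst \<sigma>) \<gamma>s"]) auto
qed

lemma RbC_gentle_explosion: "{\<^bold>\<circ> \<phi>, \<phi>, \<^bold>\<not> \<phi>} \<turnstile>\<^sub>R\<^sub>b\<^sub>C \<psi>"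
  unfolding RbC_consequence_iff
  by (rule exI [of _ "[\<^bold>\<circ> \<phi>, \<phi>, \<^bold>\<not> \<phi>]"]) (simp add: RbC_axiom bc1)

section \<open>The four-element model\<close>

text \<open>The algebra is the powerset of \<open>bool\<close>, whose atoms are
  \<open>{True}\<close> and \<open>{False}\<close>. The value of \<open>\<circ> \<alpha>\<close> is
  the complement of the meet of the values of \<open>\<alpha>\<close> and
  \<open>\<not> \<alpha>\<close>, the largest one that bc1 permits.\<close>

primrec eval :: "(nat \<Rightarrow> bool set) \<Rightarrow> fm \<Rightarrow> bool set" where
  "eval v (Var p) = v p"
| "eval v (\<alpha> \<^bold>\<and> \<beta>) = eval v \<alpha> \<inter> eval v \<beta>"
| "eval v (\<alpha> \<^bold>\<or> \<beta>) = eval v \<alpha> \<union> eval v \<beta>"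
| "eval v (\<alpha> \<^bold>\<rightarrow> \<beta>) = - eval v \<alpha> \<union> eval v \<beta>"
| "eval v (\<^bold>\<not> \<alpha>) = (if eval v \<alpha> = UNIV then {} else UNIV)"
| "eval v (\<^bold>\<circ> \<alpha>) = (if eval v \<alpha> = UNIV then UNIV else - eval v \<alpha>)"

lemma mbC_axioms_sound: "\<alpha> \<in> mbC_axioms \<Longrightarrow> eval v \<alpha> = UNIV"
  by (induction rule: mbC_axioms.induct) auto

text \<open>A biconditional takes the top value only if its two sides have equal values, hence both
  replacement rules preserve validity. Schema (cf) holds because double negation fixes the top and
  sends all other values to the bottom.\<close>

lemma RbC_theorem_sound: "RbC_theorem \<phi> \<Longrightarrow> eval v \<phi> = UNIV"
proof (induction rule: RbC_theorem_induct)
  case (mbC \<alpha>)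
  then show ?case by (rule mbC_axioms_sound)
next
  case (R_neg \<alpha> \<beta>)
  then have "eval v \<alpha> = eval v \<beta>" by auto
  then show ?case by simp
next
  case (R_circ \<alpha> \<beta>)
  then have "eval v \<alpha> = eval v \<beta>" by auto
  then show ?case by simp
qed auto

text \<open>The lattice order is used rather than mere preservation of the top: a formula and its
  negation never both have the value \<open>UNIV\<close>, so top preservation alone could not refute
  explosion.\<close>

lemma RbC_consequence_sound:
  assumes "\<Gamma> \<turnstile>\<^sub>R\<^sub>b\<^sub>C \<phi>"
  shows "(\<Inter>\<gamma>\<in>\<Gamma>. eval v \<gamma>) \<subseteq> eval v \<phi>"
proof -
  from assms obtain \<gamma>s where \<gamma>s: "set \<gamma>s \<subseteq> \<Gamma>" "RbC_theorem (foldr Imp \<gamma>s \<phi>)"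
    unfolding RbC_consequence_iff by blast
  \<comment> \<open>Iterated modus ponens in the Boolean algebra; the second factor is then the top
    by soundness for theorems and drops out.\<close>
  have "(\<Inter>\<gamma>\<in>set \<gamma>s. eval v \<gamma>) \<inter> eval v (foldr Imp \<gamma>s \<phi>) \<subseteq> eval v \<phi>"
    by (induction \<gamma>s) auto
  then have "(\<Inter>\<gamma>\<in>set \<gamma>s. eval v \<gamma>) \<subseteq> eval v \<phi>"
    by (simp add: RbC_theorem_sound [OF \<gamma>s(2)])
  with \<gamma>s(1) show ?thesis by fast
qed

lemma RbC_not_explosive: "\<not> {Var 0, \<^bold>\<not> Var 0} \<turnstile>\<^sub>R\<^sub>b\<^sub>C Var 1"
  \<comment> \<open>At the atom \<open>{True}\<close> the negation is the top, so the premises meet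
    in \<open>{True}\<close>, which is not below the empty value of \<open>Var 1\<close>.\<close>
  using RbC_consequence_sound [of "{Var 0, \<^bold>\<not> Var 0}" "Var 1" "(\<lambda>_. {})(0 := {True})"]
  by (auto simp: UNIV_bool)

lemma RbC_circ_pos: "\<not> {\<^bold>\<circ> Var 0, Var 0} \<turnstile>\<^sub>R\<^sub>b\<^sub>C Var 1"
  \<comment> \<open>With \<open>Var 0\<close> at the top, consistency is the top as well, so both
    premises hold fully.\<close>
  using RbC_consequence_sound [of "{\<^bold>\<circ> Var 0, Var 0}" "Var 1" "(\<lambda>_. {})(0 := UNIV)"]
  by auto

text \<open>At the bottom, negation and consistency both yield the top. The formulas are those of
  \<open>RbC_circ_pos\<close>, since one pair must witness both failures in the definition of an
  LFI; only the valuation changes.\<close>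

lemma RbC_circ_neg: "\<not> {\<^bold>\<circ> Var 0, \<^bold>\<not> Var 0} \<turnstile>\<^sub>R\<^sub>b\<^sub>C Var 1"
  using RbC_consequence_sound [of "{\<^bold>\<circ> Var 0, \<^bold>\<not> Var 0}" "Var 1" "\<lambda>_. {}"]
  by auto

lemma RbC_LFI: "LFI RbC_consequence"
  unfolding LFI_def
  using RbC_tarskian RbC_finitary RbC_structural RbC_not_explosive RbC_gentle_explosion
    RbC_circ_pos RbC_circ_neg by blast

theorem mainTheorem1:
  shows "(\<forall>\<Gamma> \<phi>. \<Gamma> \<turnstile>\<^sub>b\<^sub>C \<phi> \<longrightarrow> \<Gamma> \<turnstile>\<^sub>R\<^sub>b\<^sub>C \<phi>)
    \<and> replacement_property RbC_theorem
    \<and> paraconsistent RbC_consequence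
    \<and> LFI RbC_consequence"
proof (intro conjI allI impI)
  show "paraconsistent RbC_consequence"
    unfolding paraconsistent_def using RbC_not_explosive by blast
qed (fact bC_consequence_imp_RbC_consequence RbC_replacement RbC_LFI)+

end
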